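(* For integers $p,d\ge 0$, let $T_{p,d}$ be the graph consisting of a vertex $v$, $p$ pendant vertices adjacent only to $v$, and $d$ triples of vertices $\{u_i,w_i,x_i\}$ ($1\le i\le d$) with edges $u_ix_i$, $w_ix_i$, $u_iv$, $w_iv$, properly two-colored ($v$ and all $x_i$ one color; the pendants and all $u_i,w_i$ the other color). The Sprague–Grundy value of the \textsc{flag coloring} position on $T_{p,d}$ is: (i) $0$ if $p=0$ (any $d\ge0$); (ii) if $d=0$: $\ast 1$ if $p$ is odd and $\ast 2$ if $p\ge 2$ is even; (iii) $0$ if $p\ge 2$ is even and $d\ge 1$; (iv) if $p$ is odd: $\ast 3$ if $d=1$; $\ast 1$ if $d\ge 2$ is even; $\ast 2$ if $d\ge 3$ is odd.
   Context: \textsc{flag coloring} is an impartial two-player game played on a simple graph whose vertices are colored. A move consists of choosing a vertex $v$, of color $c$ say, and a color $c'\neq c$ that is the color of some vertex adjacent to $v$; then $v$ and every vertex of the connected component of the subgraph induced by color-$c$ vertices that contains $v$ are recolored $c'$. Play is under the normal play convention: a player unable to move loses. Each position gets a Sprague–Grundy value (nimber) $\ast n$, where $n$ is the minimum non-negative integer not among the values of its options (positions with no options have value $0$); $\ast 1$ is also written $\ast$. *)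

theory Defs
  imports "Graph_Theory.Graph_Theory"
begin

section \<open>Sprague--Grundy values\<close>

text \<open>
  An impartial game is given by the function \<open>opts\<close> that sends a position to the set of
  its options; the nimber \<open>*n\<close> is represented by the natural number \<open>n\<close>.
\<close>

definition mex :: "nat set \<Rightarrow> nat" where
  "mex S = (LEAST n. n \<notin> S)"

definition grundy :: "('p \<Rightarrow> 'p set) \<Rightarrow> 'p \<Rightarrow> nat" where
  "grundy opts = wfrec {(y, x). y \<in> opts x} (\<lambda>g x. mex (g ` opts x))"

lemma grundy_rec:
  assumes "wf {(y, x). y \<in> opts x}"
  shows "grundy opts x = mex (grundy opts ` opts x)"
proof -
  let ?R = "{(y, x). y \<in> opts x}"
  have "grundy opts x = mex (cut (grundy opts) ?R x ` opts x)"
    unfolding grundy_def by (subst wfrec[OF assms]) simp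
  also have "cut (grundy opts) ?R x ` opts x = grundy opts ` opts x"
    by (rule image_cong) (auto simp: cut_apply)
  finally show ?thesis .
qed


section \<open>Flag Coloring\<close>

text \<open>
  Simple graphs are the graphs of the locale \<open>pair_graph\<close>: finite, loop-free,
  with a symmetric set of arcs. A position on \<open>G\<close> is a coloring of the vertices.
\<close>

definition color_component :: "'v pair_pre_digraph \<Rightarrow> ('v \<Rightarrow> 'c) \<Rightarrow> 'v \<Rightarrow> 'v set" where
  "color_component G f v =
     {w. v \<rightarrow>\<^sup>*\<^bsub>with_proj G \<restriction> {u \<in> pverts G. f u = f v}\<^esub> w}"

definition recolor :: "'v pair_pre_digraph \<Rightarrow> ('v \<Rightarrow> 'c) \<Rightarrow> 'v \<Rightarrow> 'c \<Rightarrow> 'v \<Rightarrow> 'c" where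
  "recolor G f v c = (\<lambda>w. if w \<in> color_component G f v then c else f w)"

definition flag_moves :: "'v pair_pre_digraph \<Rightarrow> ('v \<Rightarrow> 'c) \<Rightarrow> ('v \<Rightarrow> 'c) set" where
  "flag_moves G f =
     {recolor G f v c | v c. v \<in> pverts G \<and> c \<noteq> f v \<and> (\<exists>w. (v, w) \<in> parcs G \<and> f w = c)}"

definition flag_value :: "'v pair_pre_digraph \<Rightarrow> ('v \<Rightarrow> 'c) \<Rightarrow> nat" where
  "flag_value G = grundy (flag_moves G)"

lemma color_component_self: "v \<in> pverts G \<Longrightarrow> v \<in> color_component G f v"
  by (simp add: color_component_def reachable_def)

lemma color_component_color: "w \<in> color_component G f v \<Longrightarrow> f w = f v"
  unfolding color_component_def by (auto elim: reachable_in_vertsE)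

lemma color_component_step:
  assumes "x \<in> color_component G f v" "(x, y) \<in> parcs G" "y \<in> pverts G" "f y = f v"
  shows "y \<in> color_component G f v"
proof -
  let ?H = "with_proj G \<restriction> {u \<in> pverts G. f u = f v}"
  have "x \<in> verts ?H"
    using assms(1) unfolding color_component_def by (auto elim: reachable_in_vertsE)
  then have "(x, y) \<in> arcs_ends ?H"
    using assms(2-4) by (force simp: arcs_ends_def arc_to_ends_def)
  then show ?thesis
    using assms(1,3,4) unfolding color_component_def reachable_def
    by (auto intro: rtrancl_on_into_rtrancl_on)
qed

text \<open>
  Each move strictly increases the number of monochromatic arcs, so play always terminates
  and \<open>flag_value\<close> satisfies the mex recursion.
\<close>

lemma (in pair_graph) wf_flag_moves: "wf {(g, f :: 'a \<Rightarrow> 'c). g \<in> flag_moves G f}"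
proof -
  define M where "M f = {(x, y). (x, y) \<in> parcs G \<and> f x = f y}" for f :: "'a \<Rightarrow> 'c"
  have sub: "M f \<subseteq> parcs G" for f :: "'a \<Rightarrow> 'c"
    by (auto simp: M_def)
  have fin: "finite (M f)" for f :: "'a \<Rightarrow> 'c"
    using sub pair_finite_arcs by (rule finite_subset)
  have less: "M f \<subset> M g" if gf: "g \<in> flag_moves G f" for f g :: "'a \<Rightarrow> 'c"
  proof -
    obtain v w where v: "v \<in> pverts G" "f w \<noteq> f v" "(v, w) \<in> parcs G"
      and g: "g = recolor G f v (f w)"
      using gf by (auto simp: flag_moves_def)
    let ?C = "color_component G f v"
    have sym: "(y, x) \<in> parcs G" if "(x, y) \<in> parcs G" for x y
      using pair_sym_arcs that unfolding symmetric_def with_proj_simps by (rule symD)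
    have step: "y \<in> ?C" if "x \<in> ?C" "(x, y) \<in> parcs G" "f x = f y" for x y
      using that color_component_color[OF that(1)] wellformed'(2)[OF that(2)]
      by (intro color_component_step[OF that(1,2)]) auto
    have "M f \<subseteq> M g"
    proof
      fix e assume "e \<in> M f"
      then obtain x y where e: "e = (x, y)" "(x, y) \<in> parcs G" "f x = f y"
        by (auto simp: M_def)
      then have "x \<in> ?C \<longleftrightarrow> y \<in> ?C"
        using step sym by metis
      then show "e \<in> M g"
        using e by (simp add: M_def g recolor_def)
    qed
    moreover have "w \<notin> ?C"
      using v color_component_color by metis
    then have "(v, w) \<in> M g - M f"
      using v color_component_self[OF v(1), of f] by (auto simp: M_def g recolor_def)
    ultimately show ?thesis by blast
  qed
  have "{(g, f). g \<in> flag_moves G f} \<subseteq> measure (\<lambda>f :: 'a \<Rightarrow> 'c. card (parcs G) - card (M f))"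
  proof clarify
    fix g f :: "'a \<Rightarrow> 'c" assume gf: "g \<in> flag_moves G f"
    have "card (M f) < card (M g)"
      using less[OF gf] fin by (simp add: psubset_card_mono)
    moreover have "card (M g) \<le> card (parcs G)"
      using sub pair_finite_arcs by (simp add: card_mono)
    ultimately show "(g, f) \<in> measure (\<lambda>f. card (parcs G) - card (M f))"
      by simp
  qed
  then show ?thesis
    by (rule wf_subset[OF wf_measure])
qed

lemma (in pair_graph) flag_value_rec:
  "flag_value G f = mex (flag_value G ` flag_moves G f)"
  unfolding flag_value_def by (rule grundy_rec[OF wf_flag_moves])


section \<open>The graphs \<open>T\<^bsub>p,d\<^esub>\<close>\<close>

datatype T_vertex = V | Pendant nat | U nat | W nat | X nat

definition T_verts :: "nat \<Rightarrow> nat \<Rightarrow> T_vertex set" where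
  "T_verts p d = {V} \<union> Pendant ` {..<p} \<union> U ` {..<d} \<union> W ` {..<d} \<union> X ` {..<d}"

definition T_edges :: "nat \<Rightarrow> nat \<Rightarrow> (T_vertex \<times> T_vertex) set" where
  "T_edges p d = {(V, Pendant i) | i. i < p} \<union>
     (\<Union>i<d. {(U i, X i), (W i, X i), (U i, V), (W i, V)})"

definition T :: "nat \<Rightarrow> nat \<Rightarrow> T_vertex pair_pre_digraph" where
  "T p d = \<lparr> pverts = T_verts p d, parcs = T_edges p d \<union> (T_edges p d)\<inverse> \<rparr>"

primrec T_coloring :: "'c \<Rightarrow> 'c \<Rightarrow> T_vertex \<Rightarrow> 'c" where
  "T_coloring a b V = a"
| "T_coloring a b (Pendant i) = b"
| "T_coloring a b (U i) = b"
| "T_coloring a b (W i) = b"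
| "T_coloring a b (X i) = a"

lemma pair_graph_T: "pair_graph (T p d)"
proof
  have E: "T_edges p d \<subseteq> T_verts p d \<times> T_verts p d"
    by (auto simp: T_edges_def T_verts_def)
  show fin: "finite (pverts (T p d))"
    by (simp add: T_def T_verts_def)
  have "parcs (T p d) \<subseteq> pverts (T p d) \<times> pverts (T p d)"
    using E by (auto simp: T_def)
  then show "finite (parcs (T p d))"
    using fin by (meson finite_SigmaI finite_subset)
  show "fst e \<in> pverts (T p d)" "snd e \<in> pverts (T p d)" if "e \<in> parcs (T p d)" for e
    using that E by (auto simp: T_def)
  show "fst e \<noteq> snd e" if "e \<in> parcs (T p d)" for e
    using that by (auto simp: T_def T_edges_def)
  show "symmetric (with_proj (T p d))"
    by (auto simp: symmetric_def T_def sym_def)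
qed

lemma T_coloring_proper:
  "a \<noteq> b \<Longrightarrow> (x, y) \<in> parcs (T p d) \<Longrightarrow> T_coloring a b x \<noteq> T_coloring a b y"
  by (auto simp: T_def T_edges_def)

end

theory Submission
  imports Defs
begin

text \<open>
  Compare the colors of a two-coloring of \<open>T\<^bsub>p,d\<^esub>\<close> with that of \<open>V\<close>. A triple
  whose vertices \<open>U i\<close>, \<open>W i\<close> differ from \<open>V\<close> while \<open>X i\<close> agrees is still intact; if all
  three agree with \<open>V\<close>, it has been absorbed; in each of the remaining six patterns the
  differing vertices form a single color component whose contraction is a pendant vertex.
  So contracting the color components of any two-coloring gives a properly colored
  \<open>T\<^bsub>q,e\<^esub>\<close>, and the moves lead from \<open>(q, e)\<close> to \<open>(q - 1, e)\<close>, \<open>(q + 1, e - 1)\<close> and, by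
  recoloring the center, to \<open>(e, 0)\<close>. The values follow from the mex recursion on these pairs.
\<close>

section \<open>Tools for mex, counting and color components\<close>

lemma mex_eqI: "n \<notin> S \<Longrightarrow> (\<And>m. m < n \<Longrightarrow> m \<in> S) \<Longrightarrow> mex S = n"
  unfolding mex_def by (rule Least_equality) (auto simp: not_less[symmetric])

text \<open>A move changes the status of a single index. Swapping the roles of \<open>P\<close> and
  \<open>Q\<close> makes this serve for counters that grow as well as for those that shrink.\<close>

lemma card_less_drop:
  fixes n :: nat
  assumes "i < n" "P i" "\<not> Q i" "\<And>j. j < n \<Longrightarrow> j \<noteq> i \<Longrightarrow> Q j \<longleftrightarrow> P j"
  shows "card {j. j < n \<and> P j} = Suc (card {j. j < n \<and> Q j})"
proof -
  have "{j. j < n \<and> P j} = insert i {j. j < n \<and> Q j}"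
    using assms by auto
  then show ?thesis
    using assms(3) by simp
qed

text \<open>Closure under equally colored neighbors traps every monochromatic path from
  \<open>v\<close> inside \<open>S\<close>, by induction along the path; \<open>conn\<close>
  supplies the other inclusion.\<close>

lemma color_component_eqI:
  assumes "v \<in> S"
    and closed: "\<And>x y. x \<in> S \<Longrightarrow> (x, y) \<in> parcs G \<Longrightarrow> f y = f v \<Longrightarrow> y \<in> S"
    and conn: "S \<subseteq> color_component G f v"
  shows "color_component G f v = S"
proof
  show "color_component G f v \<subseteq> S"
  proof
    fix w assume "w \<in> color_component G f v"
    then have "v \<rightarrow>\<^sup>*\<^bsub>with_proj G \<restriction> {u \<in> pverts G. f u = f v}\<^esub> w"
      by (simp add: color_component_def)
    then show "w \<in> S"
      unfolding reachable_def
    proof (induction rule: rtrancl_on_induct)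
      case base
      show ?case by (rule assms(1))
    next
      case (step x y)
      then show ?case
        by (intro closed[of x y]) (auto simp: arcs_ends_def arc_to_ends_def)
    qed
  qed
qed (rule conn)

section \<open>Two-colorings of \<open>T p d\<close> and their contracted shape\<close>

lemma T_pverts [simp]:
  "V \<in> pverts (T p d)"
  "Pendant i \<in> pverts (T p d) \<longleftrightarrow> i < p"
  "U i \<in> pverts (T p d) \<longleftrightarrow> i < d"
  "W i \<in> pverts (T p d) \<longleftrightarrow> i < d"
  "X i \<in> pverts (T p d) \<longleftrightarrow> i < d"
  by (auto simp: T_def T_verts_def)

lemma T_adjacent [simp]:
  "(V, y) \<in> parcs (T p d) \<longleftrightarrow> (\<exists>i<p. y = Pendant i) \<or> (\<exists>i<d. y = U i \<or> y = W i)"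
  "(Pendant i, y) \<in> parcs (T p d) \<longleftrightarrow> i < p \<and> y = V"
  "(U i, y) \<in> parcs (T p d) \<longleftrightarrow> i < d \<and> (y = V \<or> y = X i)"
  "(W i, y) \<in> parcs (T p d) \<longleftrightarrow> i < d \<and> (y = V \<or> y = X i)"
  "(X i, y) \<in> parcs (T p d) \<longleftrightarrow> i < d \<and> (y = U i \<or> y = W i)"
  by (auto simp: T_def T_edges_def)

text \<open>The invariant of play. It is restricted to \<open>pverts (T p d)\<close> because the
  vertex type also contains indices out of range.\<close>

definition two_colored :: "'c \<Rightarrow> 'c \<Rightarrow> nat \<Rightarrow> nat \<Rightarrow> (T_vertex \<Rightarrow> 'c) \<Rightarrow> bool" where
  "two_colored a b p d f \<longleftrightarrow> (\<forall>y\<in>pverts (T p d). f y = a \<or> f y = b)"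

lemma two_coloredD:
  assumes "two_colored a b p d f" "x \<in> pverts (T p d)" "y \<in> pverts (T p d)" "z \<in> pverts (T p d)"
    and "f x \<noteq> f z" "f y \<noteq> f z"
  shows "f x = f y"
  using assms unfolding two_colored_def by metis

definition intact :: "(T_vertex \<Rightarrow> 'c) \<Rightarrow> nat \<Rightarrow> bool" where
  "intact f i \<longleftrightarrow> f (U i) \<noteq> f V \<and> f (W i) \<noteq> f V \<and> f (X i) = f V"

definition pendantlike :: "(T_vertex \<Rightarrow> 'c) \<Rightarrow> nat \<Rightarrow> bool" where
  "pendantlike f i \<longleftrightarrow> \<not> intact f i \<and> (\<exists>y\<in>{U i, W i, X i}. f y \<noteq> f V)"

definition shape :: "nat \<Rightarrow> nat \<Rightarrow> (T_vertex \<Rightarrow> 'c) \<Rightarrow> nat \<times> nat" where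
  "shape p d f =
     (card {i. i < p \<and> f (Pendant i) \<noteq> f V} + card {i. i < d \<and> pendantlike f i},
      card {i. i < d \<and> intact f i})"

text \<open>Explicit form of the color component of \<open>V\<close>. Among the vertices colored
  like \<open>V\<close>, only the \<open>X i\<close> of an intact triple is cut off, since both its
  neighbors have a different color.\<close>

definition center_component :: "nat \<Rightarrow> nat \<Rightarrow> (T_vertex \<Rightarrow> 'c) \<Rightarrow> T_vertex set" where
  "center_component p d f =
     {y \<in> pverts (T p d). f y = f V \<and> (\<forall>i. y = X i \<longrightarrow> \<not> intact f i)}"

section \<open>Color components of a two-coloring\<close>

lemma color_component_center:
  assumes "y \<in> center_component p d f"
  shows "color_component (T p d) f y = center_component p d f"
proof (rule color_component_eqI[OF assms])
  let ?C = "color_component (T p d) f y"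
  have y: "y \<in> pverts (T p d)" "f y = f V" "\<And>i. y = X i \<Longrightarrow> \<not> intact f i"
    using assms by (auto simp: center_component_def)
  note step = color_component_step[of _ "T p d" f y]
  have self: "y \<in> ?C"
    by (rule color_component_self[OF y(1)])
  \<comment> \<open>An \<open>X i\<close> of the center's color in a triple that is not intact
    reaches \<open>V\<close> through whichever of \<open>U i\<close>, \<open>W i\<close> shares that
    color. The same route is used from \<open>V\<close> outwards below.\<close>
  have "V \<in> ?C"
  proof (cases y)
    case (X i)
    then have "i < d" and "f (U i) = f V \<or> f (W i) = f V"
      using y by (auto simp: intact_def)
    then have "U i \<in> ?C \<or> W i \<in> ?C"
      using step[OF self, of "U i"] step[OF self, of "W i"] X y by auto
    then show ?thesis
      using step[of "U i" V] step[of "W i" V] y \<open>i < d\<close> by auto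
  qed (use self y step[OF self, of V] in auto)
  note center = step[OF this]
  show "center_component p d f \<subseteq> ?C"
  proof
    fix z assume "z \<in> center_component p d f"
    then have z: "z \<in> pverts (T p d)" "f z = f V" "\<And>i. z = X i \<Longrightarrow> \<not> intact f i"
      by (auto simp: center_component_def)
    show "z \<in> ?C"
    proof (cases z)
      case (X i)
      then have "i < d" and "f (U i) = f V \<or> f (W i) = f V"
        using z by (auto simp: intact_def)
      then have "U i \<in> ?C \<and> f (U i) = f V \<or> W i \<in> ?C \<and> f (W i) = f V"
        using center[of "U i"] center[of "W i"] y by auto
      then show ?thesis
        using step[of "U i" "X i"] step[of "W i" "X i"] X z y \<open>i < d\<close> by auto
    qed (use \<open>V \<in> ?C\<close> z y center[of z] in auto)
  qed
  show "z \<in> center_component p d f"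
    if "x \<in> center_component p d f" "(x, z) \<in> parcs (T p d)" "f z = f y" for x z
    using that y by (cases x) (auto simp: center_component_def intact_def)
qed

lemma color_component_pendant:
  assumes "i < p" "f (Pendant i) \<noteq> f V"
  shows "color_component (T p d) f (Pendant i) = {Pendant i}"
  using assms by (intro color_component_eqI) (auto simp: color_component_self)

lemma color_component_intact:
  assumes "i < d" "intact f i" "y \<in> {U i, W i, X i}"
  shows "color_component (T p d) f y = {y}"
  using assms by (intro color_component_eqI) (auto simp: color_component_self intact_def)

lemma color_component_pendantlike:
  assumes "two_colored a b p d f" "i < d" "pendantlike f i" "y \<in> {U i, W i, X i}" "f y \<noteq> f V"
  shows "color_component (T p d) f y = {z \<in> {U i, W i, X i}. f z \<noteq> f V}" (is "?C = ?S")
proof (rule color_component_eqI)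
  note step = color_component_step[of _ "T p d" f y]
  have same: "f z = f y" if "z \<in> ?S" for z
    using that assms by (intro two_coloredD[OF assms(1), of z y V]) auto
  have self: "y \<in> ?C"
    using assms by (intro color_component_self) auto
  show "?S \<subseteq> ?C"
  proof
    fix z assume z: "z \<in> ?S"
    then have fz: "f z = f y" by (rule same)
    show "z \<in> ?C"
    proof (cases "z = y \<or> z = X i \<or> y = X i")
      case True
      then show ?thesis
        using self step[OF self, of z] z fz assms(2,4) by auto
    next
      case False
      \<comment> \<open>What remains is the non-adjacent pair \<open>U i\<close>,
        \<open>W i\<close>. Both differ from \<open>V\<close>, so a triple that is not intact must
        have \<open>X i\<close> differing as well, and \<open>X i\<close> links them.\<close>
      then have "f (U i) \<noteq> f V" "f (W i) \<noteq> f V"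
        using z assms(4,5) by auto
      then have "f (X i) \<noteq> f V"
        using assms(3) by (auto simp: pendantlike_def intact_def)
      then have "f (X i) = f y"
        by (intro same) auto
      then have "X i \<in> ?C"
        using False assms(2,4) by (intro step[OF self, of "X i"]) auto
      then show ?thesis
        using z fz assms(2) False by (intro step[of "X i" z]) auto
    qed
  qed
qed (use assms in auto)

section \<open>Effect of each kind of move on the shape\<close>

lemma shape_recolor_center:
  assumes "two_colored a b p d f" "y \<in> center_component p d f"
    and "c = a \<or> c = b" "c \<noteq> f y"
  shows "shape p d (recolor (T p d) f y c) = (snd (shape p d f), 0)"
proof -
  let ?g = "recolor (T p d) f y c"
  have g: "?g z = (if z \<in> center_component p d f then c else f z)" for z
    by (simp add: recolor_def color_component_center[OF assms(2)])
  have fy: "f y = f V" and V: "V \<in> center_component p d f"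
    using assms(2) by (auto simp: center_component_def intact_def)
  \<comment> \<open>A vertex of the center's color, unless it is the \<open>X i\<close> of an intact
    triple, is recolored; any other color is already \<open>c\<close>, as only two colors
    occur.\<close>
  have c: "?g z = c" if "z \<in> pverts (T p d)" "\<And>i. z = X i \<Longrightarrow> \<not> intact f i" for z
  proof (cases "f z = f V")
    case True
    then show ?thesis using that by (auto simp: g center_component_def)
  next
    case False
    moreover have "f V = a \<or> f V = b" "f z = a \<or> f z = b"
      using assms(1) that(1) by (auto simp: two_colored_def)
    ultimately show ?thesis
      using assms(3,4) fy by (auto simp: g center_component_def)
  qed
  have gV: "?g V = c"
    by (rule c) simp_all
  have "?g (Pendant i) = ?g V" if "i < p" for i
    unfolding gV by (rule c) (use that in simp_all)
  then have 1: "{i. i < p \<and> ?g (Pendant i) \<noteq> ?g V} = {}" by blast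
  have uw: "?g (U i) = ?g V" "?g (W i) = ?g V" if "i < d" for i
    unfolding gV by (rule c; use that in simp)+
  then have 2: "{i. i < d \<and> intact ?g i} = {}"
    by (auto simp: intact_def)
  \<comment> \<open>The tips \<open>X i\<close> of formerly intact triples keep the old color of
    \<open>V\<close>. They are now the only differing vertices, each of them a pendant of the
    contraction.\<close>
  have x: "?g (X i) \<noteq> ?g V \<longleftrightarrow> intact f i" if "i < d" for i
  proof (cases "intact f i")
    case True
    then have "X i \<notin> center_component p d f"
      by (auto simp: center_component_def)
    then show ?thesis
      using True assms(4) fy V by (simp add: g intact_def)
  next
    case False
    then have "?g (X i) = c"
      by (intro c) (use that in simp_all)
    then show ?thesis using False gV by simp
  qed
  have "{i. i < d \<and> pendantlike ?g i} = {i. i < d \<and> intact f i}"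
    using uw x by (auto simp: pendantlike_def intact_def[of ?g])
  with 1 2 show ?thesis
    by (simp add: shape_def)
qed

lemma shape_recolor_pendant:
  assumes "i < p" "f (Pendant i) \<noteq> f V" "shape p d f = (q, e)"
  obtains q' where "q = Suc q'" "shape p d (recolor (T p d) f (Pendant i) (f V)) = (q', e)"
proof -
  let ?g = "recolor (T p d) f (Pendant i) (f V)"
  have g: "?g = f(Pendant i := f V)"
    by (auto simp: recolor_def color_component_pendant[of i p f, OF assms(1,2)])
  have "card {j. j < p \<and> f (Pendant j) \<noteq> f V}
      = Suc (card {j. j < p \<and> ?g (Pendant j) \<noteq> ?g V})"
    using assms by (intro card_less_drop[of i]) (auto simp: g)
  moreover have "intact ?g = intact f" "pendantlike ?g = pendantlike f"
    by (auto simp: g intact_def pendantlike_def fun_eq_iff)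
  ultimately show thesis
    using that assms(3) by (simp add: shape_def)
qed

lemma shape_recolor_pendantlike:
  assumes "two_colored a b p d f" "i < d" "pendantlike f i" "y \<in> {U i, W i, X i}" "f y \<noteq> f V"
    and "shape p d f = (q, e)"
  obtains q' where "q = Suc q'" "shape p d (recolor (T p d) f y (f V)) = (q', e)"
proof -
  let ?g = "recolor (T p d) f y (f V)"
  \<comment> \<open>Vertices of the triple outside the recolored component have the color of
    \<open>V\<close> already, so the whole triple is absorbed.\<close>
  have g: "?g z = (if z \<in> {U i, W i, X i} then f V else f z)" for z
    unfolding recolor_def color_component_pendantlike[OF assms(1-5)] by auto
  have j: "intact ?g j = intact f j" "pendantlike ?g j = pendantlike f j" if "j \<noteq> i" for j
    using that by (auto simp: g intact_def pendantlike_def)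
  have i: "\<not> intact ?g i" "\<not> pendantlike ?g i" "\<not> intact f i"
    using assms(3) by (auto simp: g intact_def pendantlike_def)
  have "card {j. j < d \<and> pendantlike f j} = Suc (card {j. j < d \<and> pendantlike ?g j})"
    using assms i j by (intro card_less_drop[of i]) auto
  moreover have "intact ?g k = intact f k" for k
    using i j by (cases "k = i") auto
  ultimately show thesis
    using that assms(6) by (simp add: shape_def g)
qed

text \<open>Recoloring \<open>U i\<close> or \<open>W i\<close> gives it the color of
  \<open>V\<close>, which leaves its twin as the only differing vertex; recoloring
  \<open>X i\<close> merges the triple into one differing component. Either way an intact triple
  turns into a pendant.\<close>

lemma shape_recolor_intact:
  assumes "two_colored a b p d f" "i < d" "intact f i" "y \<in> {U i, W i, X i}"
    and "c = a \<or> c = b" "c \<noteq> f y" "shape p d f = (q, e)"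
  obtains e' where "e = Suc e'" "shape p d (recolor (T p d) f y c) = (Suc q, e')"
proof -
  let ?g = "recolor (T p d) f y c"
  have g: "?g = f(y := c)"
    by (auto simp: recolor_def color_component_intact[OF assms(2-4)])
  have j: "intact ?g j = intact f j" "pendantlike ?g j = pendantlike f j" if "j \<noteq> i" for j
    using that assms(4) by (auto simp: g intact_def pendantlike_def)
  have "f V = a \<or> f V = b" "f y = a \<or> f y = b"
    using assms by (auto simp: two_colored_def)
  then have i: "\<not> intact ?g i" "pendantlike ?g i" "\<not> pendantlike f i"
    using assms(3-6) by (auto simp: g intact_def pendantlike_def)
  have "card {j. j < d \<and> pendantlike ?g j} = Suc (card {j. j < d \<and> pendantlike f j})"
    using assms i j by (intro card_less_drop[of i]) auto
  moreover have "card {j. j < d \<and> intact f j} = Suc (card {j. j < d \<and> intact ?g j})"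
    using assms i j by (intro card_less_drop[of i]) auto
  moreover have "?g V = f V" "?g (Pendant k) = f (Pendant k)" for k
    using assms(4) by (auto simp: g)
  ultimately show thesis
    using that assms(7) by (simp add: shape_def)
qed

section \<open>Correspondence between moves and options of shapes\<close>

definition shape_opts :: "nat \<times> nat \<Rightarrow> (nat \<times> nat) set" where
  "shape_opts = (\<lambda>(q, e). {(q', e'). q = Suc q' \<and> e' = e \<or> e = Suc e' \<and> q' = Suc q \<or>
     0 < q + e \<and> q' = e \<and> e' = 0})"

lemma two_colored_flag_moves:
  assumes "two_colored a b p d f" "g \<in> flag_moves (T p d) f"
  shows "two_colored a b p d g"
proof -
  obtain v w where vw: "(v, w) \<in> parcs (T p d)" and g: "g = recolor (T p d) f v (f w)"
    using assms(2) by (auto simp: flag_moves_def)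
  interpret pair_graph "T p d" by (rule pair_graph_T)
  have "w \<in> pverts (T p d)"
    using vw by (rule wellformed'(2))
  then show ?thesis
    using assms(1) by (simp add: two_colored_def g recolor_def)
qed

text \<open>With the converse below, this identifies \<open>0 < q + e\<close> in
  \<open>shape_opts\<close> as the condition that some color differs from that of \<open>V\<close>,
  which is when the center can be recolored.\<close>

lemma shape_pos:
  assumes "y \<in> pverts (T p d)" "f y \<noteq> f V"
  shows "0 < fst (shape p d f) + snd (shape p d f)"
proof -
  have "(\<exists>i<p. f (Pendant i) \<noteq> f V) \<or> (\<exists>i<d. pendantlike f i) \<or> (\<exists>i<d. intact f i)"
    using assms by (cases y) (auto simp: pendantlike_def)
  then show ?thesis
    by (auto simp: shape_def card_gt_0_iff)
qed

lemma shape_posE: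
  assumes "0 < fst (shape p d f) + snd (shape p d f)"
  obtains y where "y \<in> pverts (T p d)" "f y \<noteq> f V"
proof -
  have "\<exists>y\<in>pverts (T p d). f y \<noteq> f V"
  proof (rule ccontr)
    assume "\<not> ?thesis"
    then have eq: "y \<in> pverts (T p d) \<Longrightarrow> f y = f V" for y
      by blast
    have "f (Pendant i) = f V" if "i < p" for i
      by (rule eq) (use that in simp)
    moreover have "f (U i) = f V" "f (W i) = f V" "f (X i) = f V" if "i < d" for i
      by (rule eq, use that in simp)+
    ultimately show False
      using assms by (auto simp: shape_def card_gt_0_iff pendantlike_def intact_def)
  qed
  then show thesis
    using that by blast
qed

lemma shape_flag_moves_subset:
  assumes f: "two_colored a b p d f" and g: "g \<in> flag_moves (T p d) f"
  shows "shape p d g \<in> shape_opts (shape p d f)"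
proof -
  obtain v w where v: "v \<in> pverts (T p d)" and vw: "(v, w) \<in> parcs (T p d)" "f w \<noteq> f v"
    and g: "g = recolor (T p d) f v (f w)"
    using g by (auto simp: flag_moves_def)
  interpret pair_graph "T p d" by (rule pair_graph_T)
  have w: "w \<in> pverts (T p d)"
    using vw(1) by (rule wellformed'(2))
  then have fw: "f w = a \<or> f w = b"
    using f by (simp add: two_colored_def)
  obtain q e where qe: "shape p d f = (q, e)" by force
  \<comment> \<open>With two colors, a vertex that differs from \<open>V\<close> can only be
    recolored to the color of \<open>V\<close>.\<close>
  have fwV: "f w = f V" if "f v \<noteq> f V"
    using two_coloredD[OF f w _ v] that vw(2) by force
  show ?thesis
  proof (cases "v \<in> center_component p d f")
    case True
    then have "f v = f V"
      by (simp add: center_component_def)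
    then have "0 < q + e"
      using shape_pos[OF w, of f] vw(2) qe by simp
    then show ?thesis
      using shape_recolor_center[OF f True fw vw(2)] by (simp add: g qe shape_opts_def)
  next
    case not_center: False
    show ?thesis
    proof (cases "\<exists>i. v \<in> {U i, W i, X i} \<and> intact f i")
      case True
      then obtain i where i: "intact f i" "v \<in> {U i, W i, X i}" by blast
      then have "i < d"
        using v by auto
      then show ?thesis
        by (rule shape_recolor_intact[OF f _ i fw vw(2) qe]) (simp add: g qe shape_opts_def)
    next
      case not_intact: False
      \<comment> \<open>A vertex colored like \<open>V\<close> outside the center component would be
        the \<open>X i\<close> of an intact triple, a case already settled.\<close>
      then have fv: "f v \<noteq> f V"
        using not_center v by (auto simp: center_component_def)
      show ?thesis
      proof (cases "\<exists>i. v = Pendant i")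
        case True
        then obtain i where i: "v = Pendant i" by blast
        show ?thesis
          by (rule shape_recolor_pendant[OF _ _ qe, of i])
            (use i v fv fwV in \<open>auto simp: g qe shape_opts_def\<close>)
      next
        case False
        then obtain i where i: "v \<in> {U i, W i, X i}"
          using fv by (cases v) auto
        then have "i < d"
          using v by auto
        moreover have "pendantlike f i"
          using i fv not_intact by (auto simp: pendantlike_def)
        ultimately show ?thesis
          by (rule shape_recolor_pendantlike[OF f _ _ i fv qe])
            (simp add: g qe shape_opts_def fwV[OF fv])
      qed
    qed
  qed
qed

lemma recolor_in_flag_moves:
  assumes "(v, w) \<in> parcs (T p d)" "f w \<noteq> f v"
  shows "recolor (T p d) f v (f w) \<in> flag_moves (T p d) f"
proof -
  interpret pair_graph "T p d" by (rule pair_graph_T)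
  show ?thesis
    using assms wellformed'(1)[OF assms(1)] by (auto simp: flag_moves_def)
qed

lemma shape_opts_subset:
  assumes f: "two_colored a b p d f" and s: "s \<in> shape_opts (shape p d f)"
  shows "s \<in> shape p d ` flag_moves (T p d) f"
proof -
  obtain q e where qe: "shape p d f = (q, e)" by force
  have fV: "f V = a \<or> f V = b"
    using f by (simp add: two_colored_def)
  consider q' where "q = Suc q'" "s = (q', e)" | e' where "e = Suc e'" "s = (Suc q, e')"
    | "0 < q + e" "s = (e, 0)"
    using s by (auto simp: qe shape_opts_def)
  then show ?thesis
  proof cases
    case (1 q')
    then have "0 < card {i. i < p \<and> f (Pendant i) \<noteq> f V} \<or> 0 < card {i. i < d \<and> pendantlike f i}"
      using qe by (auto simp: shape_def)
    then consider i where "i < p" "f (Pendant i) \<noteq> f V" | i where "i < d" "pendantlike f i"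
      by (auto simp: card_gt_0_iff)
    then show ?thesis
    proof cases
      case (1 i)
      then have "recolor (T p d) f (Pendant i) (f V) \<in> flag_moves (T p d) f"
        by (intro recolor_in_flag_moves) auto
      moreover have "shape p d (recolor (T p d) f (Pendant i) (f V)) = s"
        by (rule shape_recolor_pendant[OF 1 qe]) (use \<open>q = Suc q'\<close> \<open>s = (q', e)\<close> in auto)
      ultimately show ?thesis by blast
    next
      case (2 i)
      \<comment> \<open>A differing \<open>U i\<close> or \<open>W i\<close> borders
        \<open>V\<close>; if neither differs, then \<open>X i\<close> does and borders
        \<open>U i\<close>.\<close>
      obtain y w where y: "y \<in> {U i, W i, X i}" "f y \<noteq> f V"
        and yw: "(y, w) \<in> parcs (T p d)" "f w = f V"
      proof (cases "f (U i) = f V \<and> f (W i) = f V")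
        case True
        then show thesis
          using 2 that[of "X i" "U i"] by (auto simp: pendantlike_def)
      next
        case False
        then show thesis
          using 2 that[of "U i" V] that[of "W i" V] by auto
      qed
      then have "recolor (T p d) f y (f V) \<in> flag_moves (T p d) f"
        using recolor_in_flag_moves[of y w p d f] by auto
      moreover have "shape p d (recolor (T p d) f y (f V)) = s"
        by (rule shape_recolor_pendantlike[OF f 2 y qe])
          (use \<open>q = Suc q'\<close> \<open>s = (q', e)\<close> in auto)
      ultimately show ?thesis by blast
    qed
  next
    case (2 e')
    then have "0 < card {i. i < d \<and> intact f i}"
      using qe by (auto simp: shape_def)
    then obtain i where i: "i < d" "intact f i"
      by (auto simp: card_gt_0_iff)
    then have U: "f V \<noteq> f (U i)"
      by (auto simp: intact_def)
    then have "recolor (T p d) f (U i) (f V) \<in> flag_moves (T p d) f"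
      using i by (intro recolor_in_flag_moves) auto
    moreover have "shape p d (recolor (T p d) f (U i) (f V)) = s"
      by (rule shape_recolor_intact[OF f i _ fV U qe]) (use 2 in auto)
    ultimately show ?thesis by blast
  next
    case 3
    then obtain y where y: "y \<in> pverts (T p d)" "f y \<noteq> f V"
      using shape_posE[of p d f] qe by auto
    \<comment> \<open>The move is played at \<open>V\<close> when some neighbor of \<open>V\<close>
      differs. Otherwise the differing vertex is an \<open>X i\<close> hidden behind
      \<open>U i\<close>, and \<open>U i\<close> itself belongs to the center component.\<close>
    obtain v w where v: "v \<in> center_component p d f"
      and vw: "(v, w) \<in> parcs (T p d)" "f w \<noteq> f v" "w \<in> pverts (T p d)"
    proof (cases "\<exists>i. y = X i \<and> f (U i) = f V")
      case True
      then show thesis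
        using y that[of "U _" y] by (auto simp: center_component_def)
    next
      case False
      then have "\<exists>w. (V, w) \<in> parcs (T p d) \<and> f w \<noteq> f V \<and> w \<in> pverts (T p d)"
        using y by (cases y) (auto; metis T_pverts)+
      then show thesis
        using that[of V] by (auto simp: center_component_def)
    qed
    have "f w = a \<or> f w = b"
      using f vw(3) by (simp add: two_colored_def)
    then have "shape p d (recolor (T p d) f v (f w)) = s"
      using shape_recolor_center[OF f v _ vw(2)] 3 qe by simp
    then show ?thesis
      using recolor_in_flag_moves[OF vw(1,2)] by blast
  qed
qed

text \<open>The options match exactly in both directions, so the Grundy value of a two-coloring
  depends only on its shape.\<close>

lemma shape_flag_moves:
  assumes "two_colored a b p d f"
  shows "shape p d ` flag_moves (T p d) f = shape_opts (shape p d f)"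
  using shape_flag_moves_subset[OF assms] shape_opts_subset[OF assms] by blast

section \<open>Nimbers of the shapes\<close>

definition shape_value :: "nat \<times> nat \<Rightarrow> nat" where
  "shape_value = (\<lambda>(q, e).
     if e = 0 then (if q = 0 then 0 else if odd q then 1 else 2)
     else if even q then 0
     else if e = 1 then 3 else if even e then 1 else 2)"

text \<open>For odd \<open>q\<close> and \<open>e > 0\<close>, losing a pendant gives 0, recoloring
  the center gives 1 or 2 as \<open>e\<close> is odd or even, and opening a triple gives 2 if
  \<open>e = 1\<close> and 0 otherwise. For even \<open>q\<close> and \<open>e > 0\<close> all
  options are nonzero. For \<open>e = 0\<close> and \<open>q > 0\<close> the options are
  \<open>(q - 1, 0)\<close> and \<open>(0, 0)\<close>.\<close>

lemma shape_value_rec: "mex (shape_value ` shape_opts (q, e)) = shape_value (q, e)"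
proof (rule mex_eqI)
  show "shape_value (q, e) \<notin> shape_value ` shape_opts (q, e)"
    by (auto simp: shape_value_def shape_opts_def split: if_splits)
next
  fix m assume m: "m < shape_value (q, e)"
  have "shape_value (0, e) = 0"
    by (simp add: shape_value_def)
  \<comment> \<open>Some \<open>m\<close> lies below the value, so \<open>q\<close> is positive;
    hence the pendant move and the center move both exist.\<close>
  then obtain r where r: "q = Suc r"
    using m by (cases q) auto
  have down: "shape_value (r, e) \<in> shape_value ` shape_opts (q, e)"
    by (intro imageI) (simp add: shape_opts_def r)
  have mid: "shape_value (Suc q, e - 1) \<in> shape_value ` shape_opts (q, e)" if "0 < e"
    using that by (intro imageI) (simp add: shape_opts_def)
  have center: "shape_value (e, 0) \<in> shape_value ` shape_opts (q, e)"
    by (intro imageI) (simp add: shape_opts_def r)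
  have "m = 0 \<or> m = 1 \<or> m = 2"
    using m by (auto simp: shape_value_def split: if_splits)
  then have "m = shape_value (r, e) \<or> m = shape_value (e, 0) \<or>
      0 < e \<and> m = shape_value (Suc q, e - 1)"
    using m unfolding r by (elim disjE) (auto simp: shape_value_def odd_pos split: if_splits)
  then show "m \<in> shape_value ` shape_opts (q, e)"
    using down mid center by auto
qed

text \<open>Well-founded induction along moves: options stay two-colored, and their shapes are
  exactly the options of the shape, so both mex recursions agree.\<close>

lemma flag_value_eq_shape_value:
  "two_colored a b p d f \<Longrightarrow> flag_value (T p d) f = shape_value (shape p d f)"
proof (induction f rule: wf_induct_rule[OF pair_graph.wf_flag_moves[OF pair_graph_T[of p d]]])
  case (1 f)
  have "flag_value (T p d) ` flag_moves (T p d) f =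
      shape_value ` shape p d ` flag_moves (T p d) f"
    unfolding image_image using 1 two_colored_flag_moves[OF 1(2)] by (intro image_cong) auto
  also have "\<dots> = shape_value ` shape_opts (shape p d f)"
    by (simp add: shape_flag_moves[OF 1(2)])
  finally have "mex (flag_value (T p d) ` flag_moves (T p d) f) = shape_value (shape p d f)"
    by (metis shape_value_rec surj_pair)
  then show ?case
    by (subst pair_graph.flag_value_rec[OF pair_graph_T])
qed

lemma two_colored_T_coloring: "two_colored a b p d (T_coloring a b)"
  unfolding two_colored_def
proof
  show "T_coloring a b y = a \<or> T_coloring a b y = b" for y
    by (cases y) auto
qed

lemma shape_T_coloring:
  assumes "a \<noteq> b"
  shows "shape p d (T_coloring a b) = (p, d)"
  using assms by (simp add: shape_def pendantlike_def intact_def)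

theorem theorem2:
  fixes p d :: nat and a b :: 'c
  assumes "a \<noteq> b"
  shows "(p = 0 \<longrightarrow> flag_value (T p d) (T_coloring a b) = 0) \<and>
    (d = 0 \<longrightarrow>
       (odd p \<longrightarrow> flag_value (T p d) (T_coloring a b) = 1) \<and>
       (even p \<and> p \<ge> 2 \<longrightarrow> flag_value (T p d) (T_coloring a b) = 2)) \<and>
    (even p \<and> p \<ge> 2 \<and> d \<ge> 1 \<longrightarrow> flag_value (T p d) (T_coloring a b) = 0) \<and>
    (odd p \<longrightarrow>
       (d = 1 \<longrightarrow> flag_value (T p d) (T_coloring a b) = 3) \<and>
       (even d \<and> d \<ge> 2 \<longrightarrow> flag_value (T p d) (T_coloring a b) = 1) \<and>
       (odd d \<and> d \<ge> 3 \<longrightarrow> flag_value (T p d) (T_coloring a b) = 2))"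
  unfolding flag_value_eq_shape_value[OF two_colored_T_coloring] shape_T_coloring[OF assms]
  by (auto simp: shape_value_def)

end
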